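(* Assume Schanuel's conjecture holds. Let $f$ be an exponential polynomial over $\overline{\mathbb Q}$ such that $f(\pi)=0$. Then there exists an integer $N\geq1$ such that $\dfrac{f(x)}{e^{2ix/N}-e^{2i\pi/N}}$ is an exponential polynomial over $\overline{\mathbb Q}$.
   Context: An exponential polynomial over $\overline{\mathbb Q}$ is a function $f(x)=\sum_{i=1}^N P_i(x)e^{\beta_i x}$ with $N\ge1$, $P_i\in\overline{\mathbb Q}[X]$, $\beta_i\in\overline{\mathbb Q}$. Schanuel's conjecture: if $x_1,\dots,x_n\in\mathbb C$ are linearly independent over $\mathbb Q$, then $\overline{\mathbb Q}(x_1,\dots,x_n,e^{x_1},\dots,e^{x_n})$ has transcendence degree at least $n$ over $\overline{\mathbb Q}$. *)

theory Defs
  imports "HOL-Analysis.Analysis" "HOL-Computational_Algebra.Computational_Algebra"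
    "HOL-Library.Poly_Mapping" "HOL-Library.Extended_Nat"
begin

definition Qbar :: "complex set" where
  "Qbar = {z. algebraic z}"

definition exponential_polynomial :: "complex set \<Rightarrow> (complex \<Rightarrow> complex) \<Rightarrow> bool" where
  "exponential_polynomial K f \<longleftrightarrow>
     (\<exists>(N::nat) (P :: nat \<Rightarrow> complex poly) (\<beta> :: nat \<Rightarrow> complex). N \<ge> 1 \<and>
        (\<forall>i\<in>{1..N}. (\<forall>k. coeff (P i) k \<in> K) \<and> \<beta> i \<in> K) \<and>
        (\<forall>x. f x = (\<Sum>i=1..N. poly (P i) x * exp (\<beta> i * x))))"

global_interpretation rat_complex: vector_space "\<lambda>(q::rat) (z::complex). of_rat q * z"
  by unfold_locales (simp_all add: algebra_simps of_rat_add of_rat_mult)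

text \<open>Since \<open>inverse 0 = 0\<close>, closure under \<open>inverse\<close> need not exclude \<open>0\<close>;
  \<open>0\<close> and sums are obtained from \<open>1\<close> and differences.\<close>

definition subfield_set :: "'a::field set \<Rightarrow> bool" where
  "subfield_set F \<longleftrightarrow>
     1 \<in> F \<and> (\<forall>x\<in>F. \<forall>y\<in>F. x - y \<in> F \<and> x * y \<in> F) \<and> (\<forall>x\<in>F. inverse x \<in> F)"

definition field_adjoin :: "'a::field set \<Rightarrow> 'a set \<Rightarrow> 'a set" where
  "field_adjoin K S = subfield_set hull (K \<union> S)"

text \<open>A multivariate polynomial with variables in \<open>'v\<close> is a finitely supported map from
  monomials, themselves finitely supported exponent functions \<open>'v \<Rightarrow>\<^sub>0 nat\<close>, to coefficients.\<close>

definition mpoly_eval :: "('v \<Rightarrow> 'a) \<Rightarrow> (('v \<Rightarrow>\<^sub>0 nat) \<Rightarrow>\<^sub>0 'a) \<Rightarrow> 'a::comm_semiring_1" where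
  "mpoly_eval \<alpha> p =
     (\<Sum>m\<in>Poly_Mapping.keys p. Poly_Mapping.lookup p m *
        (\<Prod>v\<in>Poly_Mapping.keys m. \<alpha> v ^ Poly_Mapping.lookup m v))"

text \<open>The elements of \<open>B\<close> serve as their own variables: \<open>p\<close> ranges over the polynomials
  with coefficients in \<open>K\<close> and variables indexed by \<open>B\<close>, each variable being
  evaluated at its index.\<close>

definition alg_independent :: "'a::field set \<Rightarrow> 'a set \<Rightarrow> bool" where
  "alg_independent K B \<longleftrightarrow>
     (\<forall>p :: ('a \<Rightarrow>\<^sub>0 nat) \<Rightarrow>\<^sub>0 'a.
        (\<forall>m\<in>Poly_Mapping.keys p. Poly_Mapping.keys m \<subseteq> B \<and> Poly_Mapping.lookup p m \<in> K) \<and>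
        mpoly_eval (\<lambda>b. b) p = 0 \<longrightarrow> p = 0)"

text \<open>Finite subsets suffice for the supremum: subsets of algebraically independent sets are
  algebraically independent, so an infinite one forces the value \<open>\<infinity>\<close>.\<close>

definition trans_degree :: "'a::field set \<Rightarrow> 'a set \<Rightarrow> enat" where
  "trans_degree K L = Sup {enat (card B) | B. finite B \<and> B \<subseteq> L \<and> alg_independent K B}"

text \<open>Linear independence of the tuple \<open>x 1, \<dots>, x n\<close> is injectivity together with
  linear independence of its set of entries.\<close>

definition schanuel_conjecture :: bool where
  "schanuel_conjecture \<longleftrightarrow>
     (\<forall>(n::nat) (x :: nat \<Rightarrow> complex).
        inj_on x {1..n} \<and> rat_complex.independent (x ` {1..n}) \<longrightarrow>
        trans_degree Qbar (field_adjoin Qbar (x ` {1..n} \<union> (\<lambda>i. exp (x i)) ` {1..n})) \<ge> enat n)"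

end

theory Submission
  imports Defs
begin

text \<open>
  Choose a \<open>\<rat>\<close>-basis of the span of \<open>\<i>\<close> and the frequencies that contains \<open>\<i>\<close>, rescaled to
  \<open>s = \<i>/N, b\<^sub>1, \<dots>, b\<^sub>m\<close> so that every frequency is an integral combination
  \<open>\<beta>\<^sub>k = a\<^sub>k s + \<gamma>\<^sub>k\<close> with \<open>\<gamma>\<^sub>k\<close> in the span of the \<open>b\<^sub>j\<close>. Since \<open>e\<^bsup>s\<pi>\<^esup>\<close> is a root of unity,
  Schanuel's conjecture for \<open>s\<pi>, b\<^sub>1\<pi>, \<dots>, b\<^sub>m\<pi>\<close> makes \<open>\<pi>, e\<^bsup>b\<^sub>1\<pi>\<^esup>, \<dots>, e\<^bsup>b\<^sub>m\<pi>\<^esup>\<close>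
  satisfy only trivial relations over the algebraic numbers. So \<open>f(\<pi>) = 0\<close> forces
  \<open>\<Sum>\<^sub>k e\<^bsup>a\<^sub>k s\<pi>\<^esup> P\<^sub>k(x) e\<^bsup>\<gamma>\<^sub>k x\<^esup> = 0\<close> for all \<open>x\<close>. Subtracting this from \<open>f(x)\<close> leaves
  \<open>\<Sum>\<^sub>k P\<^sub>k(x) e\<^bsup>\<gamma>\<^sub>k x\<^esup> (e\<^bsup>a\<^sub>k s x\<^esup> - e\<^bsup>a\<^sub>k s\<pi>\<^esup>)\<close>, where each bracket is divisible by
  \<open>e\<^bsup>s x\<^esup> - e\<^bsup>s\<pi>\<^esup>\<close>.

  That a field generated by \<open>n\<close> elements satisfying a nontrivial relation has no \<open>n\<close> algebraically
  independent elements is shown by counting: the relation reduces the dimension of the polynomials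
  of weight at most \<open>W\<close> in the generators to \<open>O(W\<^bsup>n-1\<^esup>)\<close>, while \<open>n\<close> independent elements would
  have \<open>(d+1)\<^sup>n\<close> independent monomials of exponents at most \<open>d\<close>.
\<close>

section \<open>Linear relations over a subfield\<close>

text \<open>The linear span over a subfield that is a set rather than a type. Adding one scaled
  generator at a time turns closure properties into inductions.\<close>

inductive_set kspan :: "'a::field set \<Rightarrow> 'a set \<Rightarrow> 'a set" for K S where
  zero: "0 \<in> kspan K S"
| step: "x \<in> kspan K S \<Longrightarrow> k \<in> K \<Longrightarrow> s \<in> S \<Longrightarrow> k * s + x \<in> kspan K S"

lemma kspan_add: "x \<in> kspan K S \<Longrightarrow> y \<in> kspan K S \<Longrightarrow> x + y \<in> kspan K S"
  by (induction rule: kspan.induct) (auto simp: add.assoc intro: kspan.step)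

lemma kspan_sum: "(\<And>i. i \<in> I \<Longrightarrow> f i \<in> kspan K S) \<Longrightarrow> (\<Sum>i\<in>I. f i) \<in> kspan K S"
  by (induction I rule: infinite_finite_induct) (auto intro: kspan.zero kspan_add)

lemma kspan_empty: "x \<in> kspan K {} \<Longrightarrow> x = 0"
  by (induction rule: kspan.induct) auto

locale subfield_of =
  fixes K :: "'a::field set"
  assumes subfield: "subfield_set K"
begin

lemma K_1 [simp, intro]: "1 \<in> K"
  and K_diff [intro]: "x \<in> K \<Longrightarrow> y \<in> K \<Longrightarrow> x - y \<in> K"
  and K_mult [intro]: "x \<in> K \<Longrightarrow> y \<in> K \<Longrightarrow> x * y \<in> K"
  and K_inverse [intro]: "x \<in> K \<Longrightarrow> inverse x \<in> K"
  using subfield by (auto simp: subfield_set_def)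

lemma K_0 [simp, intro]: "0 \<in> K"
  using K_diff[of 1 1] by simp

lemma K_uminus [intro]: "x \<in> K \<Longrightarrow> - x \<in> K"
  using K_diff[of 0 x] by simp

lemma K_add [intro]: "x \<in> K \<Longrightarrow> y \<in> K \<Longrightarrow> x + y \<in> K"
  using K_diff[of x "- y"] K_uminus[of y] by simp

lemma K_divide [intro]: "x \<in> K \<Longrightarrow> y \<in> K \<Longrightarrow> x / y \<in> K"
  unfolding divide_inverse by blast

lemma K_sum [intro]: "(\<And>i. i \<in> I \<Longrightarrow> f i \<in> K) \<Longrightarrow> (\<Sum>i\<in>I. f i) \<in> K"
  by (induction I rule: infinite_finite_induct) auto

lemma K_of_nat [intro]: "of_nat n \<in> K"
  by (induction n) auto

lemma K_of_int [intro]: "of_int n \<in> K"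
  by (cases n) (auto intro: K_of_nat simp del: of_nat_Suc)

lemma kspan_base: "s \<in> S \<Longrightarrow> s \<in> kspan K S"
  using kspan.step[of 0 K S 1 s] by (simp add: kspan.zero)

lemma kspan_scale: "x \<in> kspan K S \<Longrightarrow> k \<in> K \<Longrightarrow> k * x \<in> kspan K S"
proof (induction rule: kspan.induct)
  case (step x l s)
  have "(k * l) * s + k * x \<in> kspan K S"
    using step by (intro kspan.step) auto
  then show ?case by (simp add: algebra_simps)
qed (auto intro: kspan.zero)

lemma kspan_diff: "x \<in> kspan K S \<Longrightarrow> y \<in> kspan K S \<Longrightarrow> x - y \<in> kspan K S"
  using kspan_add[of x K S "-1 * y"] kspan_scale[of y S "-1"] by auto

lemma kspan_minimal: "x \<in> kspan K S \<Longrightarrow> (\<And>s. s \<in> S \<Longrightarrow> s \<in> kspan K T) \<Longrightarrow> x \<in> kspan K T"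
  by (induction rule: kspan.induct) (auto intro: kspan.zero kspan_add kspan_scale)

lemma kspan_mono: "x \<in> kspan K S \<Longrightarrow> S \<subseteq> T \<Longrightarrow> x \<in> kspan K T"
  by (erule kspan_minimal) (auto intro: kspan_base)

lemma kspan_mult:
  assumes "x \<in> kspan K S" "y \<in> kspan K T"
    and "\<And>s t. s \<in> S \<Longrightarrow> t \<in> T \<Longrightarrow> s * t \<in> kspan K U"
  shows "x * y \<in> kspan K U"
  using assms(1)
proof (induction rule: kspan.induct)
  case (step x k s)
  have "s * y \<in> kspan K U" using assms(2)
  proof (induction rule: kspan.induct)
    case (step y l t)
    have "l * (s * t) + s * y \<in> kspan K U"
      by (rule kspan_add[OF kspan_scale[OF assms(3)]]) (use step \<open>s \<in> S\<close> in auto)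
    then show ?case by (simp add: algebra_simps)
  qed (auto intro: kspan.zero)
  then have "k * (s * y) + x * y \<in> kspan K U"
    by (rule kspan_add[OF kspan_scale]) (use step in auto)
  then show ?case by (simp add: algebra_simps)
qed (auto intro: kspan.zero)

lemma kspan_insertE:
  assumes "x \<in> kspan K (insert a S)"
  obtains k where "k \<in> K" "x - k * a \<in> kspan K S"
proof -
  from assms have "\<exists>k\<in>K. x - k * a \<in> kspan K S"
  proof (induction rule: kspan.induct)
    case zero
    then show ?case by (intro bexI[of _ 0]) (auto intro: kspan.zero)
  next
    case (step x l s)
    then obtain k where k: "k \<in> K" "x - k * a \<in> kspan K S" by auto
    show ?case
    proof (cases "s = a")
      case True
      then show ?thesis using k step by (intro bexI[of _ "l + k"]) (auto simp: algebra_simps)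
    next
      case False
      then have "l * s + (x - k * a) \<in> kspan K S" using k step by (auto intro: kspan.step)
      then show ?thesis using k by (intro bexI[of _ k]) (auto simp: algebra_simps)
    qed
  qed
  then show ?thesis using that by auto
qed

text \<open>Gaussian elimination, one spanning element at a time. The vectors form an indexed
  family, so a coincidence \<open>f t = f t'\<close> also counts as a relation; the counting
  arguments rely on this.\<close>

lemma linear_relation_exists:
  assumes "finite S" "finite T" "card S < card T" "\<And>t. t \<in> T \<Longrightarrow> f t \<in> kspan K S"
  shows "\<exists>c. (\<forall>t\<in>T. c t \<in> K) \<and> (\<exists>t\<in>T. c t \<noteq> 0) \<and> (\<Sum>t\<in>T. c t * f t) = 0"
  using assms
proof (induction S arbitrary: T f rule: finite_induct)
  case empty
  then have "f t = 0" if "t \<in> T" for t using that kspan_empty by blast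
  moreover have "T \<noteq> {}" using empty by auto
  ultimately show ?case by (intro exI[of _ "\<lambda>_. 1"]) auto
next
  case (insert s S)
  have "\<exists>k. \<forall>t\<in>T. k t \<in> K \<and> f t - k t * s \<in> kspan K S"
    using insert.prems(3) by (intro bchoice) (meson kspan_insertE)
  then obtain k where k: "\<And>t. t \<in> T \<Longrightarrow> k t \<in> K" "\<And>t. t \<in> T \<Longrightarrow> f t - k t * s \<in> kspan K S"
    by metis
  show ?case
  proof (cases "\<forall>t\<in>T. k t = 0")
    case True
    then have "\<And>t. t \<in> T \<Longrightarrow> f t \<in> kspan K S" using k by auto
    then show ?thesis using insert by auto
  next
    case False
    then obtain t0 where t0: "t0 \<in> T" "k t0 \<noteq> 0" by auto
    \<comment> \<open>The vector at \<open>t0\<close> is the pivot: subtracting its multiples clears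
      \<open>s\<close> from all the others.\<close>
    define g where "g t = f t - k t / k t0 * f t0" for t
    have g: "g t \<in> kspan K S" if "t \<in> T - {t0}" for t
    proof -
      have "g t = (f t - k t * s) - k t / k t0 * (f t0 - k t0 * s)"
        using t0 by (simp add: g_def field_simps)
      then show ?thesis
        using k[of t] k[of t0] t0 that
        by (auto intro!: kspan_diff kspan_scale simp del: times_divide_eq_left)
    qed
    have "card S < card (T - {t0})" using insert t0 by simp
    then obtain c where c: "\<forall>t\<in>T - {t0}. c t \<in> K" "\<exists>t\<in>T - {t0}. c t \<noteq> 0"
        "(\<Sum>t\<in>T - {t0}. c t * g t) = 0"
      using insert.IH[of "T - {t0}" g] g insert.prems by auto
    \<comment> \<open>The coefficient at the pivot undoes the subtractions made in
      \<open>g\<close>.\<close>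
    define d where "d t = (if t = t0 then - (\<Sum>t\<in>T - {t0}. c t * (k t / k t0)) else c t)" for t
    have "(\<Sum>t\<in>T. d t * f t) = d t0 * f t0 + (\<Sum>t\<in>T - {t0}. d t * f t)"
      using t0 insert.prems by (intro sum.remove) auto
    also have "(\<Sum>t\<in>T - {t0}. d t * f t) = (\<Sum>t\<in>T - {t0}. c t * g t + c t * (k t / k t0) * f t0)"
      by (intro sum.cong) (auto simp: d_def g_def algebra_simps)
    also have "\<dots> = (\<Sum>t\<in>T - {t0}. c t * (k t / k t0)) * f t0"
      using c(3) by (simp add: sum.distrib sum_distrib_right)
    finally have "(\<Sum>t\<in>T. d t * f t) = 0" by (simp add: d_def)
    moreover have "\<forall>t\<in>T. d t \<in> K"
      using c(1) k(1) t0 by (auto simp: d_def simp del: times_divide_eq_right intro!: K_uminus K_sum K_mult K_divide)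
    moreover have "\<exists>t\<in>T. d t \<noteq> 0" using c(2) by (auto simp: d_def)
    ultimately show ?thesis by blast
  qed
qed

end

section \<open>The field of algebraic numbers\<close>

lemma subfield_of_Rats: "subfield_of (\<rat> :: 'a::field_char_0 set)"
  by unfold_locales (auto simp: subfield_set_def)

text \<open>The \<open>card S + 1\<close> powers of exponent at most \<open>card S\<close> outnumber
  the spanning elements, and a linear relation between them is a polynomial equation for
  \<open>z\<close>.\<close>

lemma algebraic_if_powers_in_span:
  fixes z :: "'a::field_char_0"
  assumes "finite S" "\<And>n. z ^ n \<in> kspan \<rat> S"
  shows "algebraic z"
proof -
  interpret subfield_of "\<rat> :: 'a set" by (rule subfield_of_Rats)
  obtain c where c: "\<forall>n\<in>{..card S}. c n \<in> \<rat>" "\<exists>n\<in>{..card S}. c n \<noteq> 0"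
      "(\<Sum>n\<in>{..card S}. c n * z ^ n) = 0"
    using linear_relation_exists[of S "{..card S}" "\<lambda>n. z ^ n"] assms by auto
  define p where "p = (\<Sum>n\<le>card S. monom (c n) n)"
  have coeff: "coeff p n = (if n \<le> card S then c n else 0)" for n
    by (simp add: p_def coeff_sum)
  show ?thesis
  proof (rule algebraicI')
    show "coeff p n \<in> \<rat>" for n using c(1) by (auto simp: coeff)
    show "p \<noteq> 0" using c(2) coeff by (metis atMost_iff coeff_0)
    show "poly p z = 0" using c(3) by (simp add: p_def poly_sum poly_monom)
  qed
qed

lemma algebraic_powers_in_span:
  fixes x :: "'a::field_char_0"
  assumes "algebraic x"
  obtains d where "\<And>n. x ^ n \<in> kspan \<rat> ((\<lambda>i. x ^ i) ` {..<d})"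
proof -
  interpret subfield_of "\<rat> :: 'a set" by (rule subfield_of_Rats)
  obtain p where p: "\<And>i. coeff p i \<in> \<rat>" "p \<noteq> 0" "poly p x = 0"
    using assms by (auto simp: algebraic_altdef)
  let ?d = "degree p" let ?S = "(\<lambda>i. x ^ i) ` {..<?d}"
  have "coeff p ?d * x ^ ?d + (\<Sum>i<?d. coeff p i * x ^ i) = 0"
    using p(3) by (simp add: poly_altdef lessThan_Suc_atMost[symmetric] add.commute)
  moreover have "coeff p ?d \<noteq> 0" using p(2) by simp
  ultimately have "x ^ ?d = (\<Sum>i<?d. - (coeff p i / coeff p ?d) * x ^ i)"
    by (simp add: sum_negf sum_divide_distrib[symmetric] field_simps eq_neg_iff_add_eq_0)
  moreover have "(\<Sum>i<?d. - (coeff p i / coeff p ?d) * x ^ i) \<in> kspan \<rat> ?S"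
    using p(1) by (intro kspan_sum kspan_scale kspan_base) auto
  ultimately have top: "x ^ ?d \<in> kspan \<rat> ?S" by simp
  have step: "x * s \<in> kspan \<rat> ?S" if s: "s \<in> ?S" for s
  proof -
    obtain i where i: "s = x ^ i" "i < ?d" using s by auto
    show ?thesis
    proof (cases "Suc i = ?d")
      case True
      then show ?thesis using top i by (metis power_Suc)
    next
      case False
      then have "Suc i \<in> {..<?d}" using i by auto
      then have "x ^ Suc i \<in> ?S" by blast
      then show ?thesis using i by (auto intro: kspan_base)
    qed
  qed
  have "x ^ n \<in> kspan \<rat> ?S" for n
  proof (induction n)
    case 0
    show ?case
    proof (cases "?d = 0")
      case True
      then show ?thesis using top by simp
    next
      case False
      then have "x ^ 0 \<in> ?S" by blast
      then show ?thesis by (rule kspan_base)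
    qed
  next
    case (Suc n)
    have "x \<in> kspan \<rat> {x}" by (auto intro: kspan_base)
    from kspan_mult[OF this Suc.IH] show ?case using step by auto
  qed
  then show ?thesis using that by blast
qed

text \<open>The finitely many products of low powers of \<open>x\<close> and \<open>y\<close> span a
  space that contains every power of \<open>x * y\<close> and, by the binomial theorem, of
  \<open>x - y\<close>.\<close>

lemma algebraic_diff_mult:
  fixes x y :: "'a::field_char_0"
  assumes "algebraic x" "algebraic y"
  shows "algebraic (x - y)" "algebraic (x * y)"
proof -
  interpret subfield_of "\<rat> :: 'a set" by (rule subfield_of_Rats)
  obtain d where d: "\<And>n. x ^ n \<in> kspan \<rat> ((\<lambda>i. x ^ i) ` {..<d})"
    using algebraic_powers_in_span[OF assms(1)] by blast
  obtain e where e: "\<And>n. y ^ n \<in> kspan \<rat> ((\<lambda>i. y ^ i) ` {..<e})"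
    using algebraic_powers_in_span[OF assms(2)] by blast
  let ?S = "(\<lambda>(i, j). x ^ i * y ^ j) ` ({..<d} \<times> {..<e})"
  have fin: "finite ?S" by auto
  have mon: "x ^ i * y ^ j \<in> kspan \<rat> ?S" for i j
    by (rule kspan_mult[OF d e]) (auto intro: kspan_base)
  show "algebraic (x * y)"
    by (rule algebraic_if_powers_in_span[OF fin]) (simp add: power_mult_distrib mon)
  show "algebraic (x - y)"
  proof (rule algebraic_if_powers_in_span[OF fin])
    fix n
    have "(x - y) ^ n = (x + - y) ^ n" by simp
    also have "\<dots> = (\<Sum>k\<le>n. (of_nat (n choose k) * (-1) ^ (n - k)) * (x ^ k * y ^ (n - k)))"
      unfolding binomial_ring
      by (intro sum.cong refl) (metis (no_types, opaque_lifting) mult.assoc mult.left_commute power_minus)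
    also have "\<dots> \<in> kspan \<rat> ?S"
      by (intro kspan_sum kspan_scale mon) auto
    finally show "(x - y) ^ n \<in> kspan \<rat> ?S" .
  qed
qed

lemma subfield_of_Qbar: "subfield_of Qbar"
  by unfold_locales (auto simp: subfield_set_def Qbar_def intro: algebraic_diff_mult)

section \<open>Relations between generators bound the transcendence degree\<close>

definition mon :: "'v set \<Rightarrow> ('v \<Rightarrow> 'a::comm_monoid_mult) \<Rightarrow> ('v \<Rightarrow> nat) \<Rightarrow> 'a" where
  "mon I y e = (\<Prod>i\<in>I. y i ^ e i)"

definition wdeg :: "'v set \<Rightarrow> ('v \<Rightarrow> nat) \<Rightarrow> ('v \<Rightarrow> nat) \<Rightarrow> nat" where
  "wdeg I w e = (\<Sum>i\<in>I. w i * e i)"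

lemma mon_zero: "mon I y (\<lambda>_. 0) = 1"
  by (simp add: mon_def)

lemma wdeg_zero: "wdeg I w (\<lambda>_. 0) = 0"
  by (simp add: wdeg_def)

lemma mon_add: "mon I y (\<lambda>i. e i + e' i) = mon I y e * mon I y e'"
  by (simp add: mon_def power_add prod.distrib)

lemma wdeg_add: "wdeg I w (\<lambda>i. e i + e' i) = wdeg I w e + wdeg I w e'"
  by (simp add: wdeg_def algebra_simps sum.distrib)

text \<open>Exponent functions are total but only their values on \<open>I\<close> matter, hence the
  later use of \<open>restrict\<close> and \<open>extensional\<close> to choose
  representatives.\<close>

lemma mon_cong: "(\<And>i. i \<in> I \<Longrightarrow> e i = e' i) \<Longrightarrow> mon I y e = mon I y e'"
  by (simp add: mon_def)

text \<open>Base \<open>M + 1\<close> digits; this replaces a monomial order, since a relation then has a unique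
  term of greatest weight.\<close>

lemma separating_weight:
  fixes M :: nat
  assumes "finite I"
  obtains w :: "'v \<Rightarrow> nat" where "\<And>i. i \<in> I \<Longrightarrow> w i > 0"
    "\<And>e e'. (\<And>i. i \<in> I \<Longrightarrow> e i \<le> M) \<Longrightarrow> (\<And>i. i \<in> I \<Longrightarrow> e' i \<le> M) \<Longrightarrow>
      wdeg I w e = wdeg I w e' \<Longrightarrow> (\<forall>i\<in>I. e i = e' i)"
proof -
  have "\<exists>w. (\<forall>i\<in>I. w i > 0) \<and> (\<forall>e e'. (\<forall>i\<in>I. e i \<le> M) \<longrightarrow> (\<forall>i\<in>I. e' i \<le> M) \<longrightarrow>
      wdeg I w e = wdeg I w e' \<longrightarrow> (\<forall>i\<in>I. e i = e' i))"
    using assms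
  proof (induction I rule: finite_induct)
    case (insert a I)
    then obtain w where w: "\<And>i. i \<in> I \<Longrightarrow> w i > 0"
      "\<And>e e'. \<lbrakk>\<forall>i\<in>I. e i \<le> M; \<forall>i\<in>I. e' i \<le> M; wdeg I w e = wdeg I w e'\<rbrakk> \<Longrightarrow> \<forall>i\<in>I. e i = e' i"
      by blast
    define v where "v i = (if i = a then 1 else Suc M * w i)" for i
    have v: "wdeg (insert a I) v e = e a + Suc M * wdeg I w e" for e
    proof -
      have "wdeg I v e = Suc M * wdeg I w e"
        unfolding wdeg_def sum_distrib_left using insert.hyps
        by (intro sum.cong) (auto simp: v_def algebra_simps)
      then show ?thesis using insert.hyps by (simp add: wdeg_def v_def)
    qed
    show ?case
    proof (intro exI[of _ v] conjI allI impI)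
      show "\<forall>i\<in>insert a I. 0 < v i" using w(1) by (auto simp: v_def)
      fix e e' assume *: "\<forall>i\<in>insert a I. e i \<le> M" "\<forall>i\<in>insert a I. e' i \<le> M"
        "wdeg (insert a I) v e = wdeg (insert a I) v e'"
      then have eq: "e a + Suc M * wdeg I w e = e' a + Suc M * wdeg I w e'" by (simp add: v)
      have "(e a + Suc M * wdeg I w e) mod Suc M = e a" "(e' a + Suc M * wdeg I w e') mod Suc M = e' a"
        using * by (simp_all only: mod_mult_self2) (auto simp: less_Suc_eq_le)
      then have "e a = e' a" by (simp only: eq)
      with eq have "wdeg I w e = wdeg I w e'" by (simp del: mult_Suc)
      then show "\<forall>i\<in>insert a I. e i = e' i" using w(2)[of e e'] * \<open>e a = e' a\<close> by auto
    qed
  qed auto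
  then obtain w where w: "\<forall>i\<in>I. w i > 0" "\<forall>e e'. (\<forall>i\<in>I. e i \<le> M) \<longrightarrow> (\<forall>i\<in>I. e' i \<le> M) \<longrightarrow>
      wdeg I w e = wdeg I w e' \<longrightarrow> (\<forall>i\<in>I. e i = e' i)"
    by (elim exE conjE)
  show ?thesis by (rule that[of w]) (use w in blast)+
qed

lemma wdeg_ge:
  assumes "finite I" "i \<in> I" "w i > 0"
  shows "e i \<le> wdeg I w e"
proof -
  have "e i \<le> w i * e i" using assms by simp
  also have "\<dots> \<le> wdeg I w e" unfolding wdeg_def using assms by (intro member_le_sum) auto
  finally show ?thesis .
qed

text \<open>Positive weights bound every exponent by \<open>W\<close>, and one exponent lies below
  the fixed bound \<open>e0 i\<close>. So only \<open>card I - 1\<close> exponents vary with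
  \<open>W\<close>, which is the saving that drives the counting.\<close>

lemma card_reduced_monomials:
  fixes y :: "'v \<Rightarrow> 'a::comm_monoid_mult" and e0 w :: "'v \<Rightarrow> nat" and W :: nat
  assumes "finite I" "\<And>i. i \<in> I \<Longrightarrow> w i > 0"
  defines "R \<equiv> mon I y ` {e. wdeg I w e \<le> W \<and> (\<exists>i\<in>I. e i < e0 i)}"
  shows "finite R" "card R \<le> (\<Sum>i\<in>I. e0 i) * (W + 1) ^ (card I - 1)"
proof -
  \<comment> \<open>Exponent vectors whose entry at \<open>i\<close> is frozen at \<open>k\<close>
    while the others range freely up to \<open>W\<close>.\<close>
  define F where "F i k = PiE I (\<lambda>j. if j = i then {k} else {..W})" for i k
  have F: "finite (F i k)" "i \<in> I \<Longrightarrow> card (F i k) = (W + 1) ^ (card I - 1)" for i k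
  proof -
    show "finite (F i k)" unfolding F_def using assms(1) by (intro finite_PiE) auto
    assume "i \<in> I"
    have "card (F i k) = (\<Prod>j\<in>I. card (if j = i then {k} else {..W}))"
      unfolding F_def using assms(1) by (rule card_PiE)
    also have "\<dots> = (\<Prod>j\<in>I - {i}. card (if j = i then {k} else {..W}))"
      by (subst prod.remove[OF assms(1) \<open>i \<in> I\<close>]) simp
    also have "\<dots> = (\<Prod>j\<in>I - {i}. W + 1)" by (intro prod.cong) auto
    finally show "card (F i k) = (W + 1) ^ (card I - 1)" using assms(1) \<open>i \<in> I\<close> by simp
  qed
  have sub: "R \<subseteq> (\<Union>i\<in>I. \<Union>k<e0 i. mon I y ` F i k)"
  proof
    fix x assume "x \<in> R"
    then obtain e i where e: "x = mon I y e" "wdeg I w e \<le> W" "i \<in> I" "e i < e0 i"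
      unfolding R_def by auto
    have "restrict e I \<in> F i (e i)"
      unfolding F_def
    proof (rule PiE_I)
      fix j assume "j \<in> I"
      then have "e j \<le> W" using order_trans[OF wdeg_ge[OF assms(1) _ assms(2)] e(2)] by simp
      then show "restrict e I j \<in> (if j = i then {e i} else {..W})" using \<open>j \<in> I\<close> by simp
    qed auto
    moreover have "x = mon I y (restrict e I)" using e(1) by (auto intro: mon_cong)
    ultimately show "x \<in> (\<Union>i\<in>I. \<Union>k<e0 i. mon I y ` F i k)" using e(3,4) by blast
  qed
  have fin: "finite (\<Union>i\<in>I. \<Union>k<e0 i. mon I y ` F i k)" using assms(1) F(1) by auto
  show "finite R" using finite_subset[OF sub fin] .
  have "card R \<le> card (\<Union>i\<in>I. \<Union>k<e0 i. mon I y ` F i k)" by (rule card_mono[OF fin sub])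
  also have "\<dots> \<le> (\<Sum>i\<in>I. card (\<Union>k<e0 i. mon I y ` F i k))"
    by (rule card_UN_le[OF assms(1)])
  also have "\<dots> \<le> (\<Sum>i\<in>I. \<Sum>k<e0 i. card (mon I y ` F i k))"
    by (intro sum_mono card_UN_le) auto
  also have "\<dots> \<le> (\<Sum>i\<in>I. \<Sum>k<e0 i. (W + 1) ^ (card I - 1))"
  proof (intro sum_mono)
    fix i k assume "i \<in> I"
    show "card (mon I y ` F i k) \<le> (W + 1) ^ (card I - 1)"
      using card_image_le[OF F(1)[of i k], of "mon I y"] F(2)[OF \<open>i \<in> I\<close>, of k] by simp
  qed
  also have "\<dots> = (\<Sum>i\<in>I. e0 i) * (W + 1) ^ (card I - 1)" by (simp add: sum_distrib_right)
  finally show "card R \<le> (\<Sum>i\<in>I. e0 i) * (W + 1) ^ (card I - 1)" .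
qed

section \<open>Reduction of monomials modulo a relation, and the counting argument\<close>

context subfield_of
begin

text \<open>Division with remainder by the relation: a monomial divisible by the leading one is
  rewritten with monomials of smaller weight, so induction on the weight terminates in the reduced
  ones.\<close>

lemma mon_in_reduced_span:
  assumes "finite I" "finite E" "e0 \<in> E" "\<And>e. e \<in> E \<Longrightarrow> c e \<in> K" "c e0 \<noteq> 0"
    and rel: "(\<Sum>e\<in>E. c e * mon I y e) = 0"
    and top: "\<And>e. e \<in> E - {e0} \<Longrightarrow> wdeg I w e < wdeg I w e0"
  shows "wdeg I w e \<le> W \<Longrightarrow>
    mon I y e \<in> kspan K (mon I y ` {e. wdeg I w e \<le> W \<and> (\<exists>i\<in>I. e i < e0 i)})"
proof (induction "wdeg I w e" arbitrary: e rule: less_induct)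
  case less
  show ?case
  proof (cases "\<exists>i\<in>I. e i < e0 i")
    case True
    then show ?thesis using less.prems by (intro kspan_base) auto
  next
    case False
    \<comment> \<open>The truncated subtraction is exact on \<open>I\<close>, because
      \<open>e0\<close> is pointwise at most \<open>e\<close> there.\<close>
    define r where "r i = e i - e0 i" for i
    have "c e0 * mon I y e0 + (\<Sum>e\<in>E - {e0}. c e * mon I y e) = 0"
      using rel unfolding sum.remove[OF assms(2,3)] .
    then have "mon I y e0 = (\<Sum>e\<in>E - {e0}. - (c e / c e0) * mon I y e)"
      using assms(5) by (simp add: sum_negf sum_divide_distrib[symmetric] field_simps eq_neg_iff_add_eq_0)
    moreover have e: "mon I y e = mon I y (\<lambda>i. r i + e0 i)" "wdeg I w e = wdeg I w (\<lambda>i. r i + e0 i)"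
      using False by (auto simp: r_def not_less wdeg_def intro!: mon_cong sum.cong)
    ultimately have "mon I y e = (\<Sum>e\<in>E - {e0}. - (c e / c e0) * mon I y (\<lambda>i. r i + e i))"
      by (simp add: mon_add sum_distrib_left mult_ac)
    also have "\<dots> \<in> kspan K (mon I y ` {e. wdeg I w e \<le> W \<and> (\<exists>i\<in>I. e i < e0 i)})"
    proof (intro kspan_sum kspan_scale)
      fix e' assume e': "e' \<in> E - {e0}"
      then have "wdeg I w (\<lambda>i. r i + e' i) < wdeg I w e"
        using top[OF e'] e(2) by (simp add: wdeg_add)
      then show "mon I y (\<lambda>i. r i + e' i) \<in> kspan K (mon I y ` {e. wdeg I w e \<le> W \<and> (\<exists>i\<in>I. e i < e0 i)})"
        using less by auto
      show "- (c e' / c e0) \<in> K" using assms(3,4) e' by auto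
    qed
    finally show ?thesis .
  qed
qed

text \<open>Quotients of polynomial expressions in the generators already form a field containing
  \<open>K\<close> and the generators, so the hull lies inside them.\<close>

lemma field_adjoin_fractionE:
  assumes "finite I" "x \<in> field_adjoin K (y ` I)"
  obtains p q where "p \<in> kspan K (range (mon I y))" "q \<in> kspan K (range (mon I y))"
    "q \<noteq> 0" "x = p / q"
proof -
  let ?R = "kspan K (range (mon I y))"
  let ?Q = "{p / q | p q. p \<in> ?R \<and> q \<in> ?R \<and> q \<noteq> 0}"
  have one: "1 \<in> ?R" using kspan_base[OF rangeI[of "mon I y" "\<lambda>_. 0"]] by (simp add: mon_zero)
  have mult: "p * q \<in> ?R" if "p \<in> ?R" "q \<in> ?R" for p q
    using that
  proof (rule kspan_mult)
    fix s t assume "s \<in> range (mon I y)" "t \<in> range (mon I y)"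
    then show "s * t \<in> ?R" by (auto simp: mon_add[symmetric] intro: kspan_base)
  qed
  have subR: "p \<in> ?Q" if "p \<in> ?R" for p
    using that one by (intro CollectI exI[of _ p] exI[of _ 1]) auto
  have "subfield_set ?Q"
    unfolding subfield_set_def
  proof (intro conjI ballI)
    show "1 \<in> ?Q" using subR[OF one] .
    fix x assume "x \<in> ?Q"
    then obtain p q where x: "p \<in> ?R" "q \<in> ?R" "q \<noteq> 0" "x = p / q" by auto
    show "inverse x \<in> ?Q"
    \<comment> \<open>Swapping numerator and denominator fails for zero, where
      \<open>inverse 0 = 0\<close> is used instead.\<close>
    proof (cases "p = 0")
      case True
      then show ?thesis using x subR[OF kspan.zero] by simp
    next
      case False
      then show ?thesis using x by (intro CollectI exI[of _ q] exI[of _ p]) auto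
    qed
    fix x' assume "x' \<in> ?Q"
    then obtain p' q' where x': "p' \<in> ?R" "q' \<in> ?R" "q' \<noteq> 0" "x' = p' / q'" by auto
    have "x - x' = (p * q' - p' * q) / (q * q')" using x x' by (simp add: field_simps)
    then show "x - x' \<in> ?Q"
      using x x' by (intro CollectI exI[of _ "p * q' - p' * q"] exI[of _ "q * q'"]) (auto intro: mult kspan_diff)
    show "x * x' \<in> ?Q"
      using x x' by (intro CollectI exI[of _ "p * p'"] exI[of _ "q * q'"]) (auto intro: mult)
  qed
  moreover have "K \<union> y ` I \<subseteq> ?Q"
  proof -
    have "k \<in> ?R" if "k \<in> K" for k using kspan_scale[OF one that] by simp
    moreover have "y i \<in> ?R" if "i \<in> I" for i
    proof -
      have "y i = mon I y (\<lambda>j. if j = i then 1 else 0)"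
        using that assms(1) by (simp add: mon_def prod.delta if_distrib[of "\<lambda>n. _ ^ n"] cong: if_cong)
      then show ?thesis by (auto intro: kspan_base)
    qed
    ultimately show ?thesis using subR by blast
  qed
  ultimately have "field_adjoin K (y ` I) \<subseteq> ?Q"
    unfolding field_adjoin_def by (intro hull_minimal)
  with assms(2) show ?thesis using that by auto
qed

lemma kspan_mon_bounded:
  assumes "x \<in> kspan K (range (mon I y))"
  obtains D where "x \<in> kspan K (mon I y ` {e. wdeg I w e \<le> D})"
proof -
  from assms have "\<exists>D. x \<in> kspan K (mon I y ` {e. wdeg I w e \<le> D})"
  proof (induction rule: kspan.induct)
    case (step x k s)
    then obtain D e where D: "x \<in> kspan K (mon I y ` {e. wdeg I w e \<le> D})" and e: "s = mon I y e"
      by auto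
    let ?D = "max D (wdeg I w e)"
    have "k * s + x \<in> kspan K (mon I y ` {e. wdeg I w e \<le> ?D})"
      using step(2) e by (intro kspan.step kspan_mono[OF D]) auto
    then show ?case by blast
  qed (auto intro: kspan.zero)
  then show ?thesis using that by auto
qed

text \<open>Passes from finitely supported maps to exponent functions. Extensionality on
  \<open>B\<close> makes distinct elements of \<open>T\<close> distinct monomials, so their
  coefficients cannot merge.\<close>

lemma alg_independent_imp_no_relation:
  assumes "alg_independent K B" "finite B" "finite T" "T \<subseteq> extensional B"
    and "\<And>m. m \<in> T \<Longrightarrow> c m \<in> K" "(\<Sum>m\<in>T. c m * mon B (\<lambda>b. b) m) = 0" "m \<in> T"
  shows "c m = 0"
proof -
  define M where "M m = Abs_poly_mapping (\<lambda>b. if b \<in> B then m b else (0::nat))" for m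
  have M: "Poly_Mapping.lookup (M m) b = (if b \<in> B then m b else 0)" for m b
  proof -
    have "finite {b. (if b \<in> B then m b else 0) \<noteq> 0}"
      by (rule finite_subset[OF _ assms(2)]) auto
    then show ?thesis by (simp only: M_def Abs_poly_mapping_inverse mem_Collect_eq)
  qed
  have inj: "inj_on M T"
  proof (rule inj_onI)
    fix m m' assume "m \<in> T" "m' \<in> T" "M m = M m'"
    then show "m = m'" using assms(4) M[of m] M[of m'] by (intro extensionalityI[of _ B]) (metis subsetD)+
  qed
  define p where "p = (\<Sum>m\<in>T. Poly_Mapping.single (M m) (c m))"
  have p: "Poly_Mapping.lookup p n = (\<Sum>m\<in>T. if M m = n then c m else 0)" for n
    unfolding p_def by (simp add: lookup_sum lookup_single when_def)
  have pM: "Poly_Mapping.lookup p (M m) = c m" if "m \<in> T" for m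
  proof -
    have "Poly_Mapping.lookup p (M m) = (\<Sum>m'\<in>T. if m' = m then c m' else 0)"
      unfolding p using inj that by (intro sum.cong) (auto simp: inj_on_eq_iff)
    then show ?thesis using that assms(3) by simp
  qed
  have keys: "Poly_Mapping.keys p \<subseteq> M ` T"
  proof
    fix n assume "n \<in> Poly_Mapping.keys p"
    then have "Poly_Mapping.lookup p n \<noteq> 0" by (simp add: in_keys_iff)
    then obtain m where "m \<in> T" "(if M m = n then c m else 0) \<noteq> 0"
      unfolding p by (rule sum.not_neutral_contains_not_neutral)
    then show "n \<in> M ` T" by (auto split: if_splits)
  qed
  have keysM: "Poly_Mapping.keys (M m) \<subseteq> B" for m
    by (auto simp: in_keys_iff M split: if_splits)
  have monM: "(\<Prod>v\<in>Poly_Mapping.keys (M m). v ^ Poly_Mapping.lookup (M m) v) = mon B (\<lambda>b. b) m" for m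
  proof -
    have "(\<Prod>v\<in>Poly_Mapping.keys (M m). v ^ Poly_Mapping.lookup (M m) v) = (\<Prod>v\<in>B. v ^ Poly_Mapping.lookup (M m) v)"
      using keysM assms(2) by (intro prod.mono_neutral_left) (auto simp: in_keys_iff)
    then show ?thesis by (simp add: mon_def M)
  qed
  have "mpoly_eval (\<lambda>b. b) p =
      (\<Sum>n\<in>M ` T. Poly_Mapping.lookup p n * (\<Prod>v\<in>Poly_Mapping.keys n. v ^ Poly_Mapping.lookup n v))"
    unfolding mpoly_eval_def using keys assms(3) by (intro sum.mono_neutral_left) (auto simp: in_keys_iff)
  also have "\<dots> = (\<Sum>m\<in>T. c m * mon B (\<lambda>b. b) m)"
    using inj pM by (simp add: sum.reindex monM)
  finally have "mpoly_eval (\<lambda>b. b) p = 0" using assms(6) by simp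
  moreover have "\<forall>n\<in>Poly_Mapping.keys p. Poly_Mapping.keys n \<subseteq> B \<and> Poly_Mapping.lookup p n \<in> K"
  proof
    fix n assume n: "n \<in> Poly_Mapping.keys p"
    then obtain m' where "m' \<in> T" "n = M m'" using keys by auto
    then show "Poly_Mapping.keys n \<subseteq> B \<and> Poly_Mapping.lookup p n \<in> K" using keysM pM assms(5) by simp
  qed
  ultimately have "p = 0" using assms(1) unfolding alg_independent_def by blast
  then show ?thesis using pM[OF assms(7)] by simp
qed

text \<open>Once denominators are cleared, the monomials in \<open>B\<close> of exponents at most
  \<open>d\<close> have weight linear in \<open>d\<close>. The reduced monomials of that weight are
  fewer than they are when \<open>d\<close> is large, which forces a relation.\<close>

lemma alg_dependent_if_generators_related:
  assumes "finite I" "finite E" "E \<subseteq> extensional I" "\<And>e. e \<in> E \<Longrightarrow> c e \<in> K"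
    and "e1 \<in> E" "c e1 \<noteq> 0" and rel: "(\<Sum>e\<in>E. c e * mon I y e) = 0"
    and "finite B" "B \<subseteq> field_adjoin K (y ` I)" "card I \<le> card B"
  shows "\<not> alg_independent K B"
proof
  assume indep: "alg_independent K B"
  \<comment> \<open>Zero coefficients are discarded so that the coefficient of the heaviest term can
    be divided by.\<close>
  define E' where "E' = {e\<in>E. c e \<noteq> 0}"
  have E': "finite E'" "E' \<noteq> {}" "E' \<subseteq> E" using assms by (auto simp: E'_def)
  have rel': "(\<Sum>e\<in>E'. c e * mon I y e) = 0"
    using rel assms(2) unfolding E'_def by (subst (asm) sum.mono_neutral_right[of E "{e\<in>E. c e \<noteq> 0}"]) auto
  define M where "M = Max ((\<lambda>(e, i). e i) ` (E' \<times> I))"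
  have M: "e i \<le> M" if "e \<in> E'" "i \<in> I" for e i
    unfolding M_def using that E' assms(1) by (intro Max_ge) force+
  obtain w :: "'b \<Rightarrow> nat" where w: "\<And>i. i \<in> I \<Longrightarrow> w i > 0"
    "\<And>e e'. (\<And>i. i \<in> I \<Longrightarrow> e i \<le> M) \<Longrightarrow> (\<And>i. i \<in> I \<Longrightarrow> e' i \<le> M) \<Longrightarrow>
      wdeg I w e = wdeg I w e' \<Longrightarrow> (\<forall>i\<in>I. e i = e' i)"
    using separating_weight[OF assms(1)] by blast
  have "Max (wdeg I w ` E') \<in> wdeg I w ` E'" using E' by (intro Max_in) auto
  then obtain e0 where e0: "e0 \<in> E'" "wdeg I w e0 = Max (wdeg I w ` E')" by auto
  have max: "wdeg I w e \<le> wdeg I w e0" if "e \<in> E'" for e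
    using e0(2) E'(1) that by simp
  have top: "wdeg I w e < wdeg I w e0" if "e \<in> E' - {e0}" for e
  proof -
    have "wdeg I w e \<noteq> wdeg I w e0"
    proof
      assume "wdeg I w e = wdeg I w e0"
      then have "\<forall>i\<in>I. e i = e0 i" using M that e0(1) by (intro w(2)) auto
      then have "e = e0" using assms(3) E'(3) that e0(1) by (intro extensionalityI[of e I e0]) auto
      then show False using that by simp
    qed
    then show ?thesis using max[of e] that by auto
  qed
  \<comment> \<open>The filtration by weight, multiplicative in the sense that \<open>S D\<close>
    times \<open>S D'\<close> lies in \<open>S (D + D')\<close>.\<close>
  define S where "S D = kspan K (mon I y ` {e. wdeg I w e \<le> D})" for D
  have S_mono: "x \<in> S D'" if "x \<in> S D" "D \<le> D'" for x D D'
    using that unfolding S_def by (auto elim!: kspan_mono)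
  have S_mult: "x * x' \<in> S (D + D')" if "x \<in> S D" "x' \<in> S D'" for x x' D D'
    using that unfolding S_def
  proof (rule kspan_mult)
    fix s t assume "s \<in> mon I y ` {e. wdeg I w e \<le> D}" "t \<in> mon I y ` {e. wdeg I w e \<le> D'}"
    then show "s * t \<in> kspan K (mon I y ` {e. wdeg I w e \<le> D + D'})"
      by (auto simp: mon_add[symmetric] wdeg_add intro!: kspan_base imageI)
  qed
  have S_one: "1 \<in> S 0"
    unfolding S_def using kspan_base[OF imageI[of "\<lambda>_. 0" "{e. wdeg I w e \<le> 0}" "mon I y"]]
    by (simp add: mon_zero wdeg_zero)
  have S_power: "x ^ n \<in> S (n * D)" if "x \<in> S D" for x n D
    by (induction n) (use S_one S_mult[OF that] in auto)
  have S_prod: "(\<Prod>b\<in>B. x b) \<in> S (card B * D)" if "\<And>b. b \<in> B \<Longrightarrow> x b \<in> S D" for x D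
    using \<open>finite B\<close> that by (induction B rule: finite_induct) (auto intro: S_one S_mult)
  have "\<exists>p q D. p \<in> S D \<and> q \<in> S D \<and> q \<noteq> 0 \<and> b = p / q" if "b \<in> B" for b
  proof -
    have "b \<in> field_adjoin K (y ` I)" using that assms(9) by auto
    then obtain p q where pq: "p \<in> kspan K (range (mon I y))" "q \<in> kspan K (range (mon I y))"
      "q \<noteq> 0" "b = p / q" using field_adjoin_fractionE[OF assms(1)] by metis
    obtain D D' where "p \<in> S D" "q \<in> S D'"
      unfolding S_def using pq kspan_mon_bounded by metis
    then have "p \<in> S (max D D')" "q \<in> S (max D D')" by (auto elim: S_mono)
    then show ?thesis using pq by blast
  qed
  then obtain p q D0 where pq0: "\<And>b. b \<in> B \<Longrightarrow> p b \<in> S (D0 b) \<and> q b \<in> S (D0 b) \<and> q b \<noteq> 0 \<and> b = p b / q b"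
    by metis
  \<comment> \<open>A common weight bound for all numerators and denominators.\<close>
  define D where "D = (\<Sum>b\<in>B. D0 b)"
  have pq: "p b \<in> S D" "q b \<in> S D" "q b \<noteq> 0" "b = p b / q b" if "b \<in> B" for b
  proof -
    have "D0 b \<le> D" unfolding D_def using assms(8) that by (intro member_le_sum) auto
    then show "p b \<in> S D" "q b \<in> S D" using pq0[OF that] by (auto elim: S_mono)
  qed (use pq0[OF that] in auto)
  \<comment> \<open>Makes \<open>card I - 1\<close> a true predecessor. With no generators the
    relation would consist of one nonzero constant.\<close>
  have "I \<noteq> {}"
  proof
    assume "I = {}"
    then have "E' = {e0}" using top e0(1) by (auto simp: wdeg_def)
    then have "c e0 = 0" using rel' \<open>I = {}\<close> by (simp add: mon_def)
    then show False using e0(1) by (simp add: E'_def)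
  qed
  then have cardI: "card I = Suc (card I - 1)" using assms(1) by (simp add: card_gt_0_iff)
  \<comment> \<open>Since \<open>W + 1\<close> is at most \<open>(card B * D + 1) * (d + 1)\<close>,
    the set \<open>R\<close> has at most \<open>C * (d + 1) ^ (card I - 1)\<close> elements. Taking
    \<open>d = C\<close> makes this less than \<open>(d + 1) ^ card I\<close>.\<close>
  define C where "C = (\<Sum>i\<in>I. e0 i) * (card B * D + 1) ^ (card I - 1)"
  define d where "d = C"
  define W where "W = card B * (d * D)"
  define R where "R = mon I y ` {e. wdeg I w e \<le> W \<and> (\<exists>i\<in>I. e i < e0 i)}"
  have R: "finite R" "card R \<le> (\<Sum>i\<in>I. e0 i) * (W + 1) ^ (card I - 1)"
    unfolding R_def using card_reduced_monomials[OF assms(1) w(1)] by auto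
  have SR: "x \<in> kspan K R" if "x \<in> S W" for x
    using that unfolding S_def
  proof (rule kspan_minimal)
    fix s assume "s \<in> mon I y ` {e. wdeg I w e \<le> W}"
    then obtain e where "s = mon I y e" "wdeg I w e \<le> W" by auto
    then show "s \<in> kspan K R" unfolding R_def
      using mon_in_reduced_span[OF assms(1) E'(1) e0(1) _ _ rel' top, of e W] assms(4) e0(1)
      by (auto simp: E'_def)
  qed
  define T where "T = PiE B (\<lambda>_. {..d})"
  have T: "finite T" "card T = (d + 1) ^ card B"
    unfolding T_def using assms(8) by (auto simp: card_PiE intro: finite_PiE)
  \<comment> \<open>\<open>h m\<close> is the monomial of exponent \<open>m\<close> in the elements of \<open>B\<close>, cleared of denominators.\<close>
  define h where "h m = (\<Prod>b\<in>B. p b ^ m b * q b ^ (d - m b))" for m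
  have hS: "h m \<in> kspan K R" if "m \<in> T" for m
  proof (rule SR)
    show "h m \<in> S W" unfolding h_def W_def
    proof (rule S_prod)
      fix b assume b: "b \<in> B"
      then have "m b \<le> d" using that by (auto simp: T_def PiE_def Pi_def)
      then have "m b * D + (d - m b) * D = d * D" by (simp add: add_mult_distrib[symmetric])
      then show "p b ^ m b * q b ^ (d - m b) \<in> S (d * D)"
        using S_mult[OF S_power[OF pq(1)[OF b], of "m b"] S_power[OF pq(2)[OF b], of "d - m b"]] by simp
    qed
  qed
  have "card R \<le> (\<Sum>i\<in>I. e0 i) * (W + 1) ^ (card I - 1)" by (rule R(2))
  also have "\<dots> \<le> (\<Sum>i\<in>I. e0 i) * ((card B * D + 1) * (d + 1)) ^ (card I - 1)"
    by (intro mult_le_mono2 power_mono) (auto simp: W_def algebra_simps)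
  also have "\<dots> = C * (d + 1) ^ (card I - 1)" by (simp only: C_def power_mult_distrib mult.assoc)
  also have "\<dots> < (d + 1) * (d + 1) ^ (card I - 1)" by (simp add: d_def)
  also have "\<dots> = (d + 1) ^ card I" by (subst (2) cardI) simp
  also have "\<dots> \<le> (d + 1) ^ card B" by (rule power_increasing[OF assms(10)]) simp
  finally have "card R < card T" by (simp add: T)
  from linear_relation_exists[OF R(1) T(1) this, of h] hS
  obtain a where a: "\<forall>m\<in>T. a m \<in> K" "\<exists>m\<in>T. a m \<noteq> 0" "(\<Sum>m\<in>T. a m * h m) = 0"
    by auto
  \<comment> \<open>The cleared denominator does not depend on \<open>m\<close>, so it factors out
    of the relation between the \<open>h m\<close>.\<close>
  have "h m = (\<Prod>b\<in>B. q b ^ d) * mon B (\<lambda>b. b) m" if "m \<in> T" for m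
    unfolding h_def mon_def prod.distrib[symmetric]
  proof (rule prod.cong)
    fix b assume b: "b \<in> B"
    then have "m b \<le> d" using that by (auto simp: T_def PiE_def Pi_def)
    then have "q b ^ d = q b ^ m b * q b ^ (d - m b)" by (simp add: power_add[symmetric])
    moreover have "p b = b * q b" using pq(3,4)[OF b] by (simp add: field_simps)
    ultimately show "p b ^ m b * q b ^ (d - m b) = q b ^ d * b ^ m b"
      by (simp add: power_mult_distrib)
  qed simp
  then have "(\<Prod>b\<in>B. q b ^ d) * (\<Sum>m\<in>T. a m * mon B (\<lambda>b. b) m) = 0"
    using a(3) by (simp add: sum_distrib_left mult_ac cong: sum.cong)
  moreover have "(\<Prod>b\<in>B. q b ^ d) \<noteq> 0" using pq(3) assms(8) by simp
  ultimately have "(\<Sum>m\<in>T. a m * mon B (\<lambda>b. b) m) = 0" by simp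
  then have "\<forall>m\<in>T. a m = 0"
    using alg_independent_imp_no_relation[OF indep assms(8) T(1), of a] a(1)
    by (auto simp: T_def PiE_def)
  then show False using a(2) by blast
qed

text \<open>The form in which large transcendence degree is used: a relation at \<open>y\<close> has
  all its collected coefficients zero, hence persists at every other point
  \<open>y'\<close>.\<close>

lemma relation_trivial:
  assumes "finite I" "trans_degree K (field_adjoin K (y ` I)) \<ge> card I"
    and "finite J" "\<And>j. j \<in> J \<Longrightarrow> c j \<in> K" "(\<Sum>j\<in>J. c j * mon I y (e j)) = 0"
  shows "(\<Sum>j\<in>J. c j * mon I y' (e j)) = 0"
proof -
  define r where "r j = restrict (e j) I" for j
  \<comment> \<open>Different indices may give the same monomial on \<open>I\<close>, so only the
    collected coefficients must vanish.\<close>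
  define a where "a m = (\<Sum>j\<in>{j\<in>J. r j = m}. c j)" for m
  have r: "mon I y (e j) = mon I y (r j)" for j and y :: "'b \<Rightarrow> 'a"
    unfolding r_def by (auto intro: mon_cong)
  have grouped: "(\<Sum>j\<in>J. c j * mon I y (e j)) = (\<Sum>m\<in>r ` J. a m * mon I y m)" for y :: "'b \<Rightarrow> 'a"
    unfolding r sum.image_gen[OF assms(3), of _ r] a_def sum_distrib_right
    by (intro sum.cong) auto
  have "a m = 0" if "m \<in> r ` J" for m
  proof (rule ccontr)
    assume "a m \<noteq> 0"
    show False
    \<comment> \<open>The supremum argument needs \<open>card I - 1 < card I\<close>. Without
      generators the only monomial is 1 and the relation itself reads
      \<open>a m = 0\<close>.\<close>
    proof (cases "card I = 0")
      case True
      then have "r ` J = {m}" using that assms(1) by (auto simp: r_def restrict_def)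
      moreover have "(\<Sum>m\<in>r ` J. a m * mon I y m) = 0" using assms(5) by (simp only: grouped)
      ultimately show False using assms(1) True \<open>a m \<noteq> 0\<close> by (simp add: mon_def)
    next
      case False
      \<comment> \<open>The supremum may be infinite and not attained, so only a set with at least
        \<open>card I\<close> elements is extracted.\<close>
      have "\<exists>B. finite B \<and> B \<subseteq> field_adjoin K (y ` I) \<and> alg_independent K B \<and> card I \<le> card B"
      proof (rule ccontr)
        assume "\<not> ?thesis"
        then have "trans_degree K (field_adjoin K (y ` I)) \<le> enat (card I - 1)"
          unfolding trans_degree_def by (intro Sup_least) (fastforce simp: not_le)
        then have "enat (card I) \<le> enat (card I - 1)" using assms(2) by (rule order_trans[rotated])
        then show False using False by simp
      qed
      then obtain B where B: "finite B" "B \<subseteq> field_adjoin K (y ` I)" "alg_independent K B" "card I \<le> card B"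
        by blast
      have "\<not> alg_independent K B"
      proof (rule alg_dependent_if_generators_related[OF assms(1)])
        show "r ` J \<subseteq> extensional I" by (auto simp: r_def)
        show "a m \<in> K" for m unfolding a_def using assms(4) by auto
        show "(\<Sum>m\<in>r ` J. a m * mon I y m) = 0" using assms(5) by (simp add: grouped)
      qed (use assms(3) that \<open>a m \<noteq> 0\<close> B in auto)
      then show False using B(3) by blast
    qed
  qed
  then show ?thesis by (simp add: grouped)
qed

end

lemma subfield_set_field_adjoin: "subfield_set (field_adjoin K S)"
  unfolding field_adjoin_def hull_def by (auto simp: subfield_set_def)

lemma trans_degree_mono: "L \<subseteq> L' \<Longrightarrow> trans_degree K L \<le> trans_degree K L'"
  unfolding trans_degree_def by (intro Sup_subset_mono) auto

section \<open>Exponential polynomials\<close>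

lemma exponential_polynomialE:
  assumes "exponential_polynomial K f"
  obtains m :: nat and P \<beta> where "m \<ge> 1" "\<forall>i\<in>{1..m}. (\<forall>k. coeff (P i) k \<in> K) \<and> \<beta> i \<in> K"
    "\<forall>x. f x = (\<Sum>i=1..m. poly (P i) x * exp (\<beta> i * x))"
  using assms unfolding exponential_polynomial_def by (elim exE conjE) (rule that; assumption)

context
  fixes K :: "complex set"
  assumes K: "subfield_of K"
begin

interpretation subfield_of K by (rule K)

lemma exponential_polynomial_zero: "exponential_polynomial K (\<lambda>_. 0)"
  unfolding exponential_polynomial_def
  by (rule exI[of _ 1], rule exI[of _ "\<lambda>_. 0"], rule exI[of _ "\<lambda>_. 0"]) auto

lemma exponential_polynomial_add:
  assumes "exponential_polynomial K f" "exponential_polynomial K g"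
  shows "exponential_polynomial K (\<lambda>x. f x + g x)"
proof -
  obtain m :: nat and P \<beta> where f: "m \<ge> 1" "\<forall>i\<in>{1..m}. (\<forall>k. coeff (P i) k \<in> K) \<and> \<beta> i \<in> K"
    "\<forall>x. f x = (\<Sum>i=1..m. poly (P i) x * exp (\<beta> i * x))"
    using exponential_polynomialE[OF assms(1)] .
  obtain n :: nat and Q \<gamma> where g: "n \<ge> 1" "\<forall>i\<in>{1..n}. (\<forall>k. coeff (Q i) k \<in> K) \<and> \<gamma> i \<in> K"
    "\<forall>x. g x = (\<Sum>i=1..n. poly (Q i) x * exp (\<gamma> i * x))"
    using exponential_polynomialE[OF assms(2)] .
  define R where "R i = (if i \<le> m then P i else Q (i - m))" for i
  define \<delta> where "\<delta> i = (if i \<le> m then \<beta> i else \<gamma> (i - m))" for i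
  have coeffs: "\<forall>i\<in>{1..m + n}. (\<forall>k. coeff (R i) k \<in> K) \<and> \<delta> i \<in> K"
  proof
    fix i assume "i \<in> {1..m + n}"
    then have "i \<in> {1..m} \<or> \<not> i \<le> m \<and> i - m \<in> {1..n}" by auto
    then show "(\<forall>k. coeff (R i) k \<in> K) \<and> \<delta> i \<in> K" using f(2) g(2) by (auto simp: R_def \<delta>_def)
  qed
  have "f x + g x = (\<Sum>i=1..m + n. poly (R i) x * exp (\<delta> i * x))" for x
  proof -
    have "(\<Sum>i=1..m + n. poly (R i) x * exp (\<delta> i * x)) =
        (\<Sum>i=1..m. poly (R i) x * exp (\<delta> i * x)) + (\<Sum>i=m + 1..m + n. poly (R i) x * exp (\<delta> i * x))"
      by (rule sum.ub_add_nat) simp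
    also have "(\<Sum>i=m + 1..m + n. poly (R i) x * exp (\<delta> i * x)) =
        (\<Sum>i=1..n. poly (R (i + m)) x * exp (\<delta> (i + m) * x))"
      using sum.shift_bounds_cl_nat_ivl[of "\<lambda>i. poly (R i) x * exp (\<delta> i * x)" 1 m n]
      by (simp add: add.commute)
    also have "\<dots> = g x" unfolding g(3)[rule_format] by (intro sum.cong) (auto simp: R_def \<delta>_def)
    also have "(\<Sum>i=1..m. poly (R i) x * exp (\<delta> i * x)) = f x"
      unfolding f(3)[rule_format] by (intro sum.cong) (auto simp: R_def \<delta>_def)
    finally show ?thesis by simp
  qed
  then show ?thesis unfolding exponential_polynomial_def
    using coeffs f(1) by (intro exI[of _ "m + n"] exI[of _ R] exI[of _ \<delta>]) auto
qed

lemma exponential_polynomial_sum: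
  "(\<And>i. i \<in> I \<Longrightarrow> exponential_polynomial K (f i)) \<Longrightarrow> exponential_polynomial K (\<lambda>x. \<Sum>i\<in>I. f i x)"
  by (induction I rule: infinite_finite_induct)
    (auto intro: exponential_polynomial_zero exponential_polynomial_add)

lemma exponential_polynomial_mult_term:
  assumes "exponential_polynomial K f" "\<And>k. coeff Q k \<in> K" "\<gamma> \<in> K"
  shows "exponential_polynomial K (\<lambda>x. poly Q x * exp (\<gamma> * x) * f x)"
proof -
  obtain m :: nat and P \<beta> where f: "m \<ge> 1" "\<forall>i\<in>{1..m}. (\<forall>k. coeff (P i) k \<in> K) \<and> \<beta> i \<in> K"
    "\<forall>x. f x = (\<Sum>i=1..m. poly (P i) x * exp (\<beta> i * x))"
    using exponential_polynomialE[OF assms(1)] .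
  have "\<forall>i\<in>{1..m}. (\<forall>k. coeff (Q * P i) k \<in> K) \<and> \<gamma> + \<beta> i \<in> K"
    using f(2) assms(2,3) by (auto simp: coeff_mult intro!: K_sum K_mult)
  moreover have "poly Q x * exp (\<gamma> * x) * f x = (\<Sum>i=1..m. poly (Q * P i) x * exp ((\<gamma> + \<beta> i) * x))" for x
    unfolding f(3)[rule_format] sum_distrib_left
    by (intro sum.cong) (auto simp: exp_add distrib_right)
  ultimately show ?thesis unfolding exponential_polynomial_def
    using f(1) by (intro exI[of _ m] exI[of _ "\<lambda>i. Q * P i"] exI[of _ "\<lambda>i. \<gamma> + \<beta> i"]) auto
qed

lemma exponential_polynomial_scale:
  assumes "exponential_polynomial K f" "c \<in> K"
  shows "exponential_polynomial K (\<lambda>x. c * f x)"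
proof -
  have "exponential_polynomial K (\<lambda>x. poly [:c:] x * exp (0 * x) * f x)"
    using assms by (intro exponential_polynomial_mult_term) (auto simp: coeff_pCons split: nat.splits)
  then show ?thesis by simp
qed

lemma exponential_polynomial_one: "exponential_polynomial K (\<lambda>_. 1)"
  unfolding exponential_polynomial_def
  by (rule exI[of _ 1], rule exI[of _ "\<lambda>_. 1"], rule exI[of _ "\<lambda>_. 0"]) auto

text \<open>With X = exp(s x) and Z = exp(s t), this is divisibility of X^A - Z^A by X - Z among
  Laurent polynomials. Negative A is allowed because 1/X is again an exponential term; the
  hypothesis on powers of Z keeps the coefficients in \<open>K\<close>.\<close>

lemma exp_power_diff_factor:
  assumes "s \<in> K" and \<zeta>: "\<And>n. exp (of_int n * (s * t)) \<in> K"
  shows "\<exists>h. exponential_polynomial K h \<and>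
    (\<forall>x. exp (of_int A * (s * x)) - exp (of_int A * (s * t)) = (exp (s * x) - exp (s * t)) * h x)"
proof (induction A rule: int_induct[of _ 0])
  case base
  then show ?case by (intro exI[of _ "\<lambda>_. 0"]) (auto intro: exponential_polynomial_zero)
next
  case (step1 A)
  then obtain h where h: "exponential_polynomial K h"
    "\<And>x. exp (of_int A * (s * x)) - exp (of_int A * (s * t)) = (exp (s * x) - exp (s * t)) * h x"
    by blast
  \<comment> \<open>From X^(A+1) - Z^(A+1) = X (X^A - Z^A) + Z^A (X - Z).\<close>
  let ?h = "\<lambda>x. poly 1 x * exp (s * x) * h x + exp (of_int A * (s * t)) * 1"
  have "exp (of_int (A + 1) * (s * x)) - exp (of_int (A + 1) * (s * t)) = (exp (s * x) - exp (s * t)) * ?h x" for x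
  proof -
    have "exp (of_int (A + 1) * (s * x)) - exp (of_int (A + 1) * (s * t)) =
        exp (s * x) * (exp (of_int A * (s * x)) - exp (of_int A * (s * t))) +
        exp (of_int A * (s * t)) * (exp (s * x) - exp (s * t))"
      by (simp add: exp_add algebra_simps)
    then show ?thesis unfolding h(2) by (simp add: algebra_simps)
  qed
  moreover have "exponential_polynomial K ?h"
    using \<zeta>[of A] assms(1) h(1)
    by (intro exponential_polynomial_add exponential_polynomial_mult_term exponential_polynomial_scale
        exponential_polynomial_one) auto
  ultimately show ?case by (intro exI[of _ ?h] conjI allI)
next
  case (step2 A)
  then obtain h where h: "exponential_polynomial K h"
    "\<And>x. exp (of_int A * (s * x)) - exp (of_int A * (s * t)) = (exp (s * x) - exp (s * t)) * h x"
    by blast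
  \<comment> \<open>From X^(A-1) - Z^(A-1) = X^(-1) ((X^A - Z^A) - Z^(A-1) (X - Z)).\<close>
  let ?c = "- exp (of_int (A - 1) * (s * t))"
  let ?h = "\<lambda>x. poly 1 x * exp (- s * x) * (h x + ?c * 1)"
  have "exp (of_int (A - 1) * (s * x)) - exp (of_int (A - 1) * (s * t)) = (exp (s * x) - exp (s * t)) * ?h x" for x
  proof -
    have "exp (of_int (A - 1) * (s * x)) - exp (of_int (A - 1) * (s * t)) =
        exp (- s * x) * ((exp (of_int A * (s * x)) - exp (of_int A * (s * t)))
          + ?c * (exp (s * x) - exp (s * t)))"
      by (simp add: exp_add exp_diff exp_minus field_simps)
    then show ?thesis unfolding h(2) by (simp add: algebra_simps)
  qed
  moreover have "exponential_polynomial K ?h"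
    using \<zeta>[of "A - 1"] assms(1) h(1)
    by (intro exponential_polynomial_add exponential_polynomial_mult_term exponential_polynomial_scale
        exponential_polynomial_one) auto
  ultimately show ?case by (intro exI[of _ ?h] conjI allI)
qed

end

section \<open>Frequencies and Schanuel's conjecture\<close>

lemma common_denominator:
  fixes r :: "'b \<Rightarrow> rat"
  assumes "finite X"
  obtains N :: nat and a where "N \<ge> 1" "\<And>x. x \<in> X \<Longrightarrow> r x = of_int (a x) / of_nat N"
proof -
  have "\<exists>N::nat. N \<ge> 1 \<and> (\<forall>x\<in>X. \<exists>a. r x = of_int a / of_nat N)"
    using assms
  proof (induction X rule: finite_induct)
    case (insert x X)
    then obtain N :: nat where N: "N \<ge> 1" "\<And>x. x \<in> X \<Longrightarrow> \<exists>a. r x = of_int a / of_nat N" by auto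
    obtain p q where pq: "q > 0" "r x = of_int p / of_int q"
      using quotient_of_div quotient_of_denom_pos by (metis prod.exhaust)
    have q: "of_nat (N * nat q) = (of_nat N * of_int q :: rat)" using pq(1) by simp
    have "r x = of_int (p * int N) / of_nat (N * nat q)"
      unfolding q using N(1) pq(1) by (simp add: pq(2))
    moreover have "\<exists>a. r x' = of_int a / of_nat (N * nat q)" if x': "x' \<in> X" for x'
    proof -
      obtain a where "r x' = of_int a / of_nat N" using N(2)[OF x'] by blast
      then have "r x' = of_int (a * q) / of_nat (N * nat q)" unfolding q using pq(1) by simp
      then show ?thesis by blast
    qed
    ultimately have "\<forall>x'\<in>insert x X. \<exists>a. r x' = of_int a / of_nat (N * nat q)" by blast
    moreover have "N * nat q \<ge> 1" using N(1) pq(1) by (simp add: Suc_le_eq)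
    ultimately show ?case by blast
  qed auto
  then obtain N :: nat where "N \<ge> 1" "\<forall>x\<in>X. \<exists>a. r x = of_int a / of_nat N" by blast
  then show ?thesis using that bchoice[of X "\<lambda>x a. r x = of_int a / of_nat N"] by blast
qed

lemma independent_scale:
  assumes "rat_complex.independent B" "c \<noteq> 0"
  shows "rat_complex.independent ((\<lambda>b. c * b) ` B)"
proof
  assume "rat_complex.dependent ((\<lambda>b. c * b) ` B)"
  then obtain T u where T: "finite T" "T \<subseteq> (\<lambda>b. c * b) ` B" "(\<Sum>v\<in>T. of_rat (u v) * v) = 0" "\<exists>v\<in>T. u v \<noteq> 0"
    unfolding rat_complex.dependent_explicit by blast
  obtain T' where T': "T' \<subseteq> B" "finite T'" "T = (\<lambda>b. c * b) ` T'"
    using finite_subset_image[OF T(1,2)] by blast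
  have "inj_on (\<lambda>b. c * b) T'" using assms(2) by (auto intro: inj_onI)
  then have "c * (\<Sum>v\<in>T'. of_rat (u (c * v)) * v) = 0"
    using T(3) by (simp add: T'(3) sum.reindex sum_distrib_left mult_ac)
  then have "(\<Sum>v\<in>T'. of_rat (u (c * v)) * v) = 0" using assms(2) by simp
  moreover have "\<exists>v\<in>T'. u (c * v) \<noteq> 0" using T(4) T'(3) by auto
  ultimately have "rat_complex.dependent B"
    unfolding rat_complex.dependent_explicit using T'(1,2)
    by (intro exI[of _ T'] exI[of _ "\<lambda>v. u (c * v)"] conjI)
  then show False using assms(1) by blast
qed

text \<open>Extending \<open>{v}\<close> to a maximal independent subset of
  \<open>insert v X\<close> keeps \<open>v\<close> in the basis and takes all basis elements from
  the given numbers, so they stay algebraic if those are. One denominator for all coordinates then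
  makes them integral.\<close>

lemma integral_coordinates:
  assumes "finite X" "v \<noteq> 0"
  obtains B N a where "v \<in> B" "B \<subseteq> insert v X" "rat_complex.independent B" "N \<ge> (1::nat)"
    "\<And>x. x \<in> X \<Longrightarrow> x = (\<Sum>b\<in>B. of_int (a x b) * (b / of_nat N))"
proof -
  have "rat_complex.independent {v}" using assms(2) by simp
  then obtain B where B: "{v} \<subseteq> B" "B \<subseteq> insert v X" "rat_complex.independent B"
      "insert v X \<subseteq> rat_complex.span B"
    using rat_complex.maximal_independent_subset_extend[of "{v}" "insert v X"] by auto
  have fin: "finite B" using B(2) assms(1) finite_subset by blast
  have "\<exists>u. x = (\<Sum>b\<in>B. of_rat (u b) * b)" if "x \<in> X" for x
    using B(4) that unfolding rat_complex.span_finite[OF fin] by auto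
  then obtain u where u: "\<And>x. x \<in> X \<Longrightarrow> x = (\<Sum>b\<in>B. of_rat (u x b) * b)" by metis
  obtain N a where N: "N \<ge> (1::nat)" "\<And>z. z \<in> X \<times> B \<Longrightarrow> (\<lambda>(x, b). u x b) z = of_int (a z) / of_nat N"
    using common_denominator[of "X \<times> B" "\<lambda>(x, b). u x b"] assms(1) fin by (metis finite_cartesian_product)
  have "x = (\<Sum>b\<in>B. of_int (a (x, b)) * (b / of_nat N))" if x: "x \<in> X" for x
  proof -
    have "x = (\<Sum>b\<in>B. of_rat (u x b) * b)" by (rule u[OF x])
    also have "\<dots> = (\<Sum>b\<in>B. of_int (a (x, b)) * (b / of_nat N))"
    proof (rule sum.cong)
      fix b assume "b \<in> B"
      then have "u x b = of_int (a (x, b)) / of_nat N" using N(2)[of "(x, b)"] x by simp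
      then show "of_rat (u x b) * b = of_int (a (x, b)) * (b / of_nat N)"
        by (simp add: of_rat_divide)
    qed simp
    finally show ?thesis .
  qed
  then show ?thesis using that[of B N "\<lambda>x b. a (x, b)"] B N(1) by auto
qed

section \<open>Schanuel's conjecture at multiples of pi and the factorization\<close>

lemma schanuel_set:
  assumes schanuel_conjecture "finite X" "rat_complex.independent X"
  shows "trans_degree Qbar (field_adjoin Qbar (X \<union> exp ` X)) \<ge> card X"
proof -
  obtain x where x: "bij_betw x {1..card X} X" using ex_bij_betw_nat_finite_1[OF assms(2)] by blast
  then have X: "inj_on x {1..card X}" "x ` {1..card X} = X" by (auto simp: bij_betw_def)
  moreover have "(\<lambda>i. exp (x i)) ` {1..card X} = exp ` X" using X(2) by (auto simp: image_image[symmetric])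
  ultimately show ?thesis using assms(1,3) unfolding schanuel_conjecture_def by metis
qed

text \<open>The number is a root of unity: its power of exponent \<open>2 * N\<close> is 1.\<close>

lemma exp_pi_rational_in_Qbar:
  assumes "N \<ge> 1"
  shows "exp (of_int A * (\<i> / of_nat N * of_real pi)) \<in> Qbar"
proof -
  let ?z = "exp (of_int A * (\<i> / of_nat N * of_real pi))"
  have "?z ^ (2 * N) = exp (of_nat (2 * N) * (of_int A * (\<i> / of_nat N * of_real pi)))"
    by (rule exp_of_nat_mult[symmetric])
  also have "\<dots> = exp (2 * of_int A * of_real pi * \<i>)" using assms by (simp add: field_simps)
  also have "\<dots> = 1" using exp_integer_2pi[of "real_of_int A"] by (simp add: mult_ac)
  finally have root: "poly (monom 1 (2 * N)) ?z = 1" by (simp only: poly_monom mult_1_left)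
  have "\<forall>i. coeff (monom 1 (2 * N) :: complex poly) i \<in> \<int>" by simp
  moreover have "degree (monom 1 (2 * N) :: complex poly) = 2 * N" by (simp add: degree_monom_eq)
  ultimately have "algebraic ?z"
    using algebraic_root[OF algebraic_1 root] assms by simp
  then show ?thesis by (simp add: Qbar_def)
qed

theorem theorem4:
  fixes f :: "complex \<Rightarrow> complex"
  assumes "schanuel_conjecture"
    and "exponential_polynomial Qbar f"
    and "f (of_real pi) = 0"
  shows "\<exists>N::nat. N \<ge> 1 \<and>
    (\<exists>g. exponential_polynomial Qbar g \<and>
      (\<forall>x. exp (2 * \<i> * x / of_nat N) - exp (2 * \<i> * of_real pi / of_nat N) \<noteq> 0 \<longrightarrow>
        f x / (exp (2 * \<i> * x / of_nat N) - exp (2 * \<i> * of_real pi / of_nat N)) = g x))"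
proof -
  interpret Qbar: subfield_of Qbar by (rule subfield_of_Qbar)
  obtain n P \<beta> where "n \<ge> (1::nat)" and f': "\<forall>i\<in>{1..n}. (\<forall>k. coeff (P i) k \<in> Qbar) \<and> \<beta> i \<in> Qbar"
    "\<forall>x. f x = (\<Sum>i=1..n. poly (P i) x * exp (\<beta> i * x))"
    using exponential_polynomialE[OF assms(2)] .
  have f: "\<And>i k. i \<in> {1..n} \<Longrightarrow> coeff (P i) k \<in> Qbar" "\<And>i. i \<in> {1..n} \<Longrightarrow> \<beta> i \<in> Qbar"
    "\<And>x. f x = (\<Sum>i=1..n. poly (P i) x * exp (\<beta> i * x))"
    using f' by simp_all
  obtain B N a0 where B: "\<i> \<in> B" "B \<subseteq> insert \<i> (\<beta> ` {1..n})" "rat_complex.independent B"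
    and N: "N \<ge> (1::nat)"
    and a0: "\<And>x. x \<in> \<beta> ` {1..n} \<Longrightarrow> x = (\<Sum>b\<in>B. of_int (a0 x b) * (b / of_nat N))"
    using integral_coordinates[of "\<beta> ` {1..n}" \<i>] by auto
  have finB: "finite B" using B(2) by (rule finite_subset) simp
  have BQ: "b \<in> Qbar" if "b \<in> B" for b
    using that B(2) f(2) by (auto simp: Qbar_def)
  define a where "a i = a0 (\<beta> i)" for i
  define s where "s = \<i> / of_nat N"
  define \<gamma> where "\<gamma> i = (\<Sum>b\<in>B - {\<i>}. of_int (a i b) * (b / of_nat N))" for i
  have sQ: "s \<in> Qbar" unfolding s_def using BQ[OF B(1)] by auto
  have \<beta>: "\<beta> i = of_int (a i \<i>) * s + \<gamma> i" if "i \<in> {1..n}" for i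
  proof -
    have "\<beta> i = (\<Sum>b\<in>B. of_int (a i b) * (b / of_nat N))"
      using a0[of "\<beta> i"] that by (auto simp: a_def)
    then show ?thesis unfolding sum.remove[OF finB B(1)] s_def \<gamma>_def .
  qed
  have \<gamma>Q: "\<gamma> i \<in> Qbar" for i
    unfolding \<gamma>_def using BQ by (intro Qbar.K_sum) (auto intro!: Qbar.K_mult Qbar.K_divide Qbar.K_of_int Qbar.K_of_nat)
  have \<zeta>: "exp (of_int A * (s * of_real pi)) \<in> Qbar" for A
    unfolding s_def by (rule exp_pi_rational_in_Qbar[OF N])
  \<comment> \<open>The slot of \<open>\<i>\<close>, whose exponential is algebraic, is taken by \<open>\<pi>\<close> itself.\<close>
  define y where "y t b = (if b = \<i> then t else exp (t * b / of_nat N))" for t b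
  \<comment> \<open>Schanuel's conjecture is applied to the numbers \<open>pi * b / N\<close> for
    \<open>b\<close> in \<open>B\<close>. They and their exponentials lie in the field generated by
    the \<open>card B\<close> values of \<open>y\<close>, since the exponential belonging to \<i> is
    algebraic.\<close>
  have "trans_degree Qbar (field_adjoin Qbar (y (of_real pi) ` B)) \<ge> card B"
  proof -
    let ?L = "field_adjoin Qbar (y (of_real pi) ` B)"
    let ?c = "of_real pi / of_nat N :: complex"
    let ?X = "(\<lambda>b. ?c * b) ` B"
    interpret L: subfield_of ?L by unfold_locales (rule subfield_set_field_adjoin)
    have c: "?c \<noteq> 0" using N by simp
    have QL: "z \<in> ?L" if "z \<in> Qbar" for z
      using that unfolding field_adjoin_def by (intro hull_inc) auto
    have yL: "y (of_real pi) b \<in> ?L" if "b \<in> B" for b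
      using that unfolding field_adjoin_def by (intro hull_inc) auto
    have piL: "of_real pi \<in> ?L" using yL[OF B(1)] by (simp add: y_def)
    have "?c * b \<in> ?L" if "b \<in> B" for b
      using piL QL[OF BQ[OF that]] by auto
    moreover have "exp (?c * b) \<in> ?L" if "b \<in> B" for b
    proof (cases "b = \<i>")
      case True
      then show ?thesis using QL[OF \<zeta>[of 1]] by (simp add: s_def mult_ac)
    next
      case False
      then show ?thesis using yL[OF that] by (simp add: y_def)
    qed
    ultimately have "field_adjoin Qbar (?X \<union> exp ` ?X) \<subseteq> ?L"
      unfolding field_adjoin_def[of Qbar "?X \<union> exp ` ?X"] using QL
      by (intro hull_minimal subfield_set_field_adjoin) auto
    moreover have "card ?X = card B" using c by (intro card_image inj_onI) auto
    ultimately show ?thesis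
      using schanuel_set[OF assms(1) _ independent_scale[OF B(3) c]] finB
        trans_degree_mono[of "field_adjoin Qbar (?X \<union> exp ` ?X)" ?L Qbar] by fastforce
  qed
  note trivial = Qbar.relation_trivial[OF finB this]
  define M where "M = (\<Sum>i=1..n. \<Sum>b\<in>B. \<bar>a i b\<bar>)"
  have M: "a i b + M \<ge> 0" if "i \<in> {1..n}" "b \<in> B" for i b
  proof -
    have "\<bar>a i b\<bar> \<le> (\<Sum>b\<in>B. \<bar>a i b\<bar>)" using that finB by (intro member_le_sum) auto
    also have "\<dots> \<le> M" unfolding M_def using that by (intro member_le_sum) (auto intro: sum_nonneg)
    finally show ?thesis by simp
  qed
  \<comment> \<open>\<open>M\<close> shifts all exponents to be nonnegative, at the cost of a common factor \<open>exp (\<sigma> * x)\<close>.\<close>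
  define \<sigma> where "\<sigma> = (\<Sum>b\<in>B - {\<i>}. of_int M * (b / of_nat N))"
  \<comment> \<open>An index \<open>(i, l)\<close> stands for the term of degree \<open>l\<close> in
    \<open>P i\<close>; the exponent \<open>l\<close> goes to the slot of \<i>, where
    \<open>y x\<close> has the value \<open>x\<close>.\<close>
  define J where "J = Sigma {1..n} (\<lambda>i. {..degree (P i)})"
  define c where "c = (\<lambda>(i, l). exp (of_int (a i \<i>) * (s * of_real pi)) * coeff (P i) l)"
  define e where "e = (\<lambda>(i, l) b. if b = \<i> then l else nat (a i b + M))"
  define F where "F x = (\<Sum>i=1..n. exp (of_int (a i \<i>) * (s * of_real pi)) * poly (P i) x * exp (\<gamma> i * x))" for x
  have mon: "mon B (y x) (e (i, l)) = x ^ l * exp (\<gamma> i * x) * exp (\<sigma> * x)" if "i \<in> {1..n}" for i l x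
  proof -
    have "mon B (y x) (e (i, l)) = x ^ l * (\<Prod>b\<in>B - {\<i>}. y x b ^ e (i, l) b)"
      unfolding mon_def prod.remove[OF finB B(1)] by (simp add: y_def e_def)
    also have "(\<Prod>b\<in>B - {\<i>}. y x b ^ e (i, l) b) =
        (\<Prod>b\<in>B - {\<i>}. exp ((of_int (a i b) * (b / of_nat N) + of_int M * (b / of_nat N)) * x))"
    proof (rule prod.cong)
      fix b assume b: "b \<in> B - {\<i>}"
      then have "of_nat (nat (a i b + M)) = (of_int (a i b + M) :: complex)" using M[OF that, of b] by simp
      then show "y x b ^ e (i, l) b = exp ((of_int (a i b) * (b / of_nat N) + of_int M * (b / of_nat N)) * x)"
        using b by (simp add: y_def e_def exp_of_nat_mult[symmetric] algebra_simps)
    qed simp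
    also have "\<dots> = exp ((\<gamma> i + \<sigma>) * x)"
      unfolding \<gamma>_def \<sigma>_def sum.distrib[symmetric] sum_distrib_right using finB by (simp add: exp_sum)
    finally show ?thesis by (simp add: exp_add distrib_right)
  qed
  have sumJ: "(\<Sum>j\<in>J. c j * mon B (y x) (e j)) = exp (\<sigma> * x) * F x" for x
  proof -
    have "(\<Sum>j\<in>J. c j * mon B (y x) (e j)) = (\<Sum>i=1..n. \<Sum>l\<le>degree (P i). c (i, l) * mon B (y x) (e (i, l)))"
      unfolding J_def by (subst sum.Sigma) auto
    also have "\<dots> = (\<Sum>i=1..n. \<Sum>l\<le>degree (P i). exp (\<sigma> * x) *
        (exp (of_int (a i \<i>) * (s * of_real pi)) * (coeff (P i) l * x ^ l) * exp (\<gamma> i * x)))"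
      by (intro sum.cong refl) (simp add: mon c_def mult_ac)
    also have "\<dots> = exp (\<sigma> * x) * F x"
      by (simp add: F_def poly_altdef sum_distrib_left sum_distrib_right)
    finally show ?thesis .
  qed
  have "F (of_real pi) = f (of_real pi)"
    unfolding F_def f(3) by (intro sum.cong) (auto simp: \<beta> algebra_simps exp_add)
  then have "(\<Sum>j\<in>J. c j * mon B (y (of_real pi)) (e j)) = 0" by (simp add: sumJ assms(3))
  moreover have "c j \<in> Qbar" if j: "j \<in> J" for j
  proof -
    obtain i l where "j = (i, l)" "i \<in> {1..n}" using j unfolding J_def by blast
    then show ?thesis unfolding c_def using f(1) \<zeta> by (simp add: Qbar.K_mult)
  qed
  moreover have "finite J" unfolding J_def by auto
  \<comment> \<open>The relation holds at \<open>y pi\<close>, so it transfers to \<open>y x\<close>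
    for every \<open>x\<close>; the nonzero factor \<open>exp (\<sigma> * x)\<close> then
    cancels.\<close>
  ultimately have "(\<Sum>j\<in>J. c j * mon B (y x) (e j)) = 0" for x
    using trivial[of J c e "y x"] by simp
  then have F0: "F x = 0" for x using sumJ[of x] by simp
  have "\<forall>A. \<exists>h. exponential_polynomial Qbar h \<and> (\<forall>x. exp (of_int A * (s * x)) -
      exp (of_int A * (s * of_real pi)) = (exp (s * x) - exp (s * of_real pi)) * h x)"
    using exp_power_diff_factor[OF subfield_of_Qbar sQ \<zeta>] by (rule allI)
  from choice[OF this]
  obtain h where h: "\<And>A. exponential_polynomial Qbar (h A)"
    "\<And>A x. exp (of_int A * (s * x)) - exp (of_int A * (s * of_real pi)) = (exp (s * x) - exp (s * of_real pi)) * h A x"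
    by blast
  define g where "g x = (\<Sum>i=1..n. poly (P i) x * exp (\<gamma> i * x) * h (a i \<i>) x)" for x
  have "exponential_polynomial Qbar g"
    unfolding g_def using f(1) \<gamma>Q h(1)
    by (intro exponential_polynomial_sum exponential_polynomial_mult_term subfield_of_Qbar) auto
  moreover have "f x = (exp (s * x) - exp (s * of_real pi)) * g x" for x
  proof -
    have "f x = f x - F x" by (simp add: F0)
    also have "\<dots> = (\<Sum>i=1..n. poly (P i) x * exp (\<gamma> i * x) *
        (exp (of_int (a i \<i>) * (s * x)) - exp (of_int (a i \<i>) * (s * of_real pi))))"
      unfolding f(3) F_def sum_subtractf[symmetric]
      by (intro sum.cong) (auto simp: \<beta> distrib_right exp_add algebra_simps)
    also have "\<dots> = (exp (s * x) - exp (s * of_real pi)) * g x"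
      unfolding h(2) g_def sum_distrib_left by (simp add: mult_ac)
    finally show ?thesis .
  qed
  \<comment> \<open>The exponent sought is \<open>2 * \<i> * x / N'\<close> whereas \<open>s\<close>
    is \<open>\<i> / N\<close>, so the witness is \<open>N' = 2 * N\<close>.\<close>
  moreover have "s * x = 2 * \<i> * x / of_nat (2 * N)" for x by (simp add: s_def)
  ultimately show ?thesis using N
    by (intro exI[of _ "2 * N"] conjI exI[of _ g]) auto
qed

end
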